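(* The algorithm described in the context (computing $\mathrm{dir}(\mathcal X^\star(\mathcal C))$) terminates with probability $1$ after $\dim\mathrm{dir}(\mathcal X^\star(\mathcal C))\le d$ steps (iterations of its while loop) and outputs a basis of $\mathrm{dir}(\mathcal X^\star(\mathcal C))$.
   Context: Let $A\in\mathbb R^{m\times d}$, $b\in\mathbb R^m$, and let $\mathcal X=\{x\in\mathbb R^d: Ax=b,\ x\ge 0\}$, assumed nonempty and bounded. Let $\mathcal C\subset\mathbb R^d$ be a nonempty uncertainty set. Let $\mathcal X^\star(\mathcal C)=\bigcup_{c\in\mathcal C}\arg\min_{x\in\mathcal X}c^\top x$ and, for $S\subset\mathbb R^d$, $\mathrm{dir}(S)=\mathrm{span}\{x_1-x_2:x_1,x_2\in S\}$. $\mathrm{proj}_W$ denotes orthogonal projection onto a subspace $W$. Algorithm. Input: $\mathcal X$ (through $A,b$) and $\mathcal C$. 1. Initialize $\mathcal D=\varnothing$. Choose some $c_0\in\mathcal C$ and some $x_0\in\arg\min_{x\in\mathcal X}c_0^\top x$. Sample $\alpha\sim\mathcal N(0,I_d)$. 2. While at least one of the two problems "minimize" / "maximize" $$\alpha^\top\mathrm{proj}_{(\mathrm{span}\,\mathcal D)^\perp}(x_0-x)$$ over $x\ge0$, $\lambda\in\mathbb R^m$, $s\in\mathbb R_+^d$, $c\in\mathcal C$, $\tau\in\{0,1\}^d$ subject to $Ax=b$, $A^\top\lambda+s=c$, and $1-\epsilon s_i\ge\tau_i\ge\epsilon x_i$ for all $i\in\{1,\dots,d\}$, has a solution with $x$-component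 $x^\star$ and nonzero optimal value: replace $\mathcal D$ by $\mathcal D\cup\{x^\star-x_0\}$ and resample $\alpha\sim\mathcal N(0,I_d)$ independently of the past. 3. Return $\mathcal D$. Here $\epsilon>0$ is a fixed constant small enough that the constraints exactly encode the optimality (complementary slackness) conditions, i.e. the set of all $x\ge 0$ for which there exist $\lambda\in\mathbb R^m$, $s\in\mathbb R_+^d$, $c\in\mathcal C$ and $\tau\in\{0,1\}^d$ satisfying $Ax=b$, $A^\top\lambda+s=c$, and $1-\epsilon s_i\ge\tau_i\ge\epsilon x_i$ for all $i\in\{1,\dots,d\}$ is exactly $\mathcal X^\star(\mathcal C)$. *)

theory Defs
  imports "HOL-Probability.Probability"
begin

definition feasible_region :: "real^'d^'m \<Rightarrow> real^'m \<Rightarrow> (real^'d) set" where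
  "feasible_region A b = {x. A *v x = b \<and> (\<forall>i. 0 \<le> x $ i)}"

definition argmin_linear :: "real^'d \<Rightarrow> (real^'d) set \<Rightarrow> (real^'d) set" where
  "argmin_linear c X = {x. is_arg_min (\<lambda>y. c \<bullet> y) (\<lambda>y. y \<in> X) x}"

definition reachable_optima :: "real^'d^'m \<Rightarrow> real^'m \<Rightarrow> (real^'d) set \<Rightarrow> (real^'d) set" where
  "reachable_optima A b C = (\<Union>c\<in>C. argmin_linear c (feasible_region A b))"

definition dir :: "(real^'d) set \<Rightarrow> (real^'d) set" where
  "dir S = span {x1 - x2 | x1 x2. x1 \<in> S \<and> x2 \<in> S}"

definition orth_proj :: "(real^'d) set \<Rightarrow> real^'d \<Rightarrow> real^'d" where
  "orth_proj W x = (THE y. y \<in> W \<and> (\<forall>w\<in>W. orthogonal (x - y) w))"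

lemma orth_proj_eqI:
  assumes "subspace W" "y \<in> W" "\<And>w. w \<in> W \<Longrightarrow> orthogonal (x - y) w"
  shows "orth_proj W x = y"
  unfolding orth_proj_def
proof (rule the_equality)
  show "y \<in> W \<and> (\<forall>w\<in>W. orthogonal (x - y) w)"
    using assms by blast
next
  fix z assume z: "z \<in> W \<and> (\<forall>w\<in>W. orthogonal (x - z) w)"
  then have "z - y \<in> W"
    using assms(1,2) subspace_diff by blast
  then have "(x - y) \<bullet> (z - y) = 0" "(x - z) \<bullet> (z - y) = 0"
    using z assms(3) by (auto simp: orthogonal_def)
  then have "(z - y) \<bullet> (z - y) = 0"
    by (simp add: inner_diff_left)
  then show "z = y" by simp
qed

lemma orth_proj:
  assumes "subspace W"
  shows "orth_proj W x \<in> W" "\<And>w. w \<in> W \<Longrightarrow> orthogonal (x - orth_proj W x) w"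
proof -
  obtain y z where "y \<in> span W" "\<And>w. w \<in> span W \<Longrightarrow> orthogonal z w" "x = y + z"
    by (rule orthogonal_subspace_decomp_exists[of W x]) blast
  moreover have "span W = W"
    using assms by (simp add: span_eq_iff)
  ultimately have y: "y \<in> W" "\<And>w. w \<in> W \<Longrightarrow> orthogonal (x - y) w"
    by auto
  then have "orth_proj W x = y"
    using assms by (intro orth_proj_eqI)
  with y show "orth_proj W x \<in> W" "\<And>w. w \<in> W \<Longrightarrow> orthogonal (x - orth_proj W x) w"
    by auto
qed

(* The variables are (x, lam, s, c, tau). *)
definition milp_feasible ::
  "real^'d^'m \<Rightarrow> real^'m \<Rightarrow> (real^'d) set \<Rightarrow> real
    \<Rightarrow> ((real^'d) \<times> (real^'m) \<times> (real^'d) \<times> (real^'d) \<times> (real^'d)) set" where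
  "milp_feasible A b C eps = {(x, lam, s, c, tau).
     A *v x = b \<and> (\<forall>i. 0 \<le> x $ i) \<and> (\<forall>i. 0 \<le> s $ i) \<and> c \<in> C \<and> (\<forall>i. tau $ i \<in> {0, 1}) \<and>
     transpose A *v lam + s = c \<and>
     (\<forall>i. 1 - eps * s $ i \<ge> tau $ i \<and> tau $ i \<ge> eps * x $ i)}"

definition milp_objective ::
  "real^'d \<Rightarrow> real^'d \<Rightarrow> (real^'d) set
    \<Rightarrow> (real^'d) \<times> (real^'m) \<times> (real^'d) \<times> (real^'d) \<times> (real^'d) \<Rightarrow> real" where
  "milp_objective x0 a D = (\<lambda>(x, lam, s, c, tau).
     a \<bullet> orth_proj (orthogonal_comp (span D)) (x0 - x))"

(* The x-components of the minimizers and maximizers with nonzero optimal value. *)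
definition loop_candidates ::
  "real^'d^'m \<Rightarrow> real^'m \<Rightarrow> (real^'d) set \<Rightarrow> real \<Rightarrow> real^'d \<Rightarrow> real^'d \<Rightarrow> (real^'d) set
    \<Rightarrow> (real^'d) set" where
  "loop_candidates A b C eps x0 a D = {x. \<exists>lam s c tau.
     (is_arg_min (milp_objective x0 a D) (\<lambda>z. z \<in> milp_feasible A b C eps) (x, lam, s, c, tau) \<or>
      is_arg_max (milp_objective x0 a D) (\<lambda>z. z \<in> milp_feasible A b C eps) (x, lam, s, c, tau)) \<and>
     milp_objective x0 a D (x, lam, s, c, tau) \<noteq> 0}"

definition loop_guard ::
  "real^'d^'m \<Rightarrow> real^'m \<Rightarrow> (real^'d) set \<Rightarrow> real \<Rightarrow> real^'d \<Rightarrow> real^'d \<Rightarrow> (real^'d) set \<Rightarrow> bool" where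
  "loop_guard A b C eps x0 a D \<longleftrightarrow> loop_candidates A b C eps x0 a D \<noteq> {}"

(* a k is the sample in force at the k-th test of the loop guard, and D k is the set held at that
   time. Solvers may return any optimal solution, so one sample sequence a can have many executions.
   The values of D after the guard first fails are irrelevant and left unconstrained. *)
definition execution ::
  "real^'d^'m \<Rightarrow> real^'m \<Rightarrow> (real^'d) set \<Rightarrow> real \<Rightarrow> real^'d \<Rightarrow> (nat \<Rightarrow> real^'d)
    \<Rightarrow> (nat \<Rightarrow> (real^'d) set) \<Rightarrow> bool" where
  "execution A b C eps x0 a D \<longleftrightarrow> D 0 = {} \<and>
     (\<forall>k. (\<forall>j\<le>k. loop_guard A b C eps x0 (a j) (D j)) \<longrightarrow>
       (\<exists>x \<in> loop_candidates A b C eps x0 (a k) (D k). D (Suc k) = D k \<union> {x - x0}))"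

definition terminates_after ::
  "real^'d^'m \<Rightarrow> real^'m \<Rightarrow> (real^'d) set \<Rightarrow> real \<Rightarrow> real^'d \<Rightarrow> (nat \<Rightarrow> real^'d)
    \<Rightarrow> (nat \<Rightarrow> (real^'d) set) \<Rightarrow> nat \<Rightarrow> bool" where
  "terminates_after A b C eps x0 a D n \<longleftrightarrow>
     (\<forall>k<n. loop_guard A b C eps x0 (a k) (D k)) \<and> \<not> loop_guard A b C eps x0 (a n) (D n)"

lemma execution_exists: "\<exists>D. execution A b C eps x0 a D"
proof -
  define pick where "pick k D = (SOME x. x \<in> loop_candidates A b C eps x0 (a k) D)" for k D
  define D where "D = rec_nat {} (\<lambda>k E. E \<union> {pick k E - x0})"
  have "execution A b C eps x0 a D"
    unfolding execution_def
  proof (intro conjI allI impI)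
    show "D 0 = {}" by (simp add: D_def)
  next
    fix k assume "\<forall>j\<le>k. loop_guard A b C eps x0 (a j) (D j)"
    then have "loop_candidates A b C eps x0 (a k) (D k) \<noteq> {}"
      by (simp add: loop_guard_def)
    then have "pick k (D k) \<in> loop_candidates A b C eps x0 (a k) (D k)"
      unfolding pick_def by (simp add: some_in_eq)
    moreover have "D (Suc k) = D k \<union> {pick k (D k) - x0}"
      by (simp add: D_def)
    ultimately show "\<exists>x \<in> loop_candidates A b C eps x0 (a k) (D k). D (Suc k) = D k \<union> {x - x0}"
      by blast
  qed
  then show ?thesis by blast
qed

(* Density of N(0, I) with respect to Lebesgue measure. *)
definition std_gaussian_density :: "real^'d \<Rightarrow> real" where
  "std_gaussian_density x = (\<Prod>i\<in>UNIV. std_normal_density (x $ i))"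

end

theory Submission
  imports Defs
begin

text \<open>
  The reachable optima form a union of faces of a polytope; let \<open>V\<close> be the finite set of vertices of
  these faces. Modulo \<open>span D\<close>, a generic linear objective attains its minimum (or maximum) over the
  union only at the class of one vertex, and its optimal values both vanish only if \<open>span D\<close> is the
  whole direction space. Hence, whichever optimal solution the solver returns, \<open>span D\<close> stays
  inside the finite family of spans of sets \<open>{v - x0 | v \<in> T}\<close> with \<open>T \<subseteq> V\<close>. Each sample therefore
  only has to avoid finitely many hyperplanes fixed in advance, so one null set serves all executions.
\<close>

subsection \<open>Orthogonal projections\<close>

text \<open>Both sides equal \<open>orth_proj U a \<bullet> orth_proj U z\<close>, since each
  residual is orthogonal to \<open>U\<close>. Moving the projection onto the sample turns the
  objective of the program into an ordinary linear functional of x.\<close>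

lemma orth_proj_adjoint:
  assumes "subspace U"
  shows "a \<bullet> orth_proj U z = orth_proj U a \<bullet> z"
proof -
  have "(a - orth_proj U a) \<bullet> orth_proj U z = 0" "(z - orth_proj U z) \<bullet> orth_proj U a = 0"
    using orth_proj[OF assms] by (auto simp: orthogonal_def)
  then show ?thesis
    by (simp add: inner_diff_left) (metis inner_commute)
qed

lemma orth_proj_orthogonal_comp_eq_0_iff:
  assumes "subspace W"
  shows "orth_proj (orthogonal_comp W) z = 0 \<longleftrightarrow> z \<in> W"
proof
  assume "orth_proj (orthogonal_comp W) z = 0"
  then have "orthogonal z w" if "w \<in> orthogonal_comp W" for w
    using orth_proj(2)[OF subspace_orthogonal_comp that, of z] by simp
  then have "z \<in> orthogonal_comp (orthogonal_comp W)"
    by (auto simp: orthogonal_comp_def orthogonal_commute)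
  then show "z \<in> W"
    using orthogonal_comp_self[OF assms] by simp
next
  assume "z \<in> W"
  then show "orth_proj (orthogonal_comp W) z = 0"
    using subspace_orthogonal_comp
    by (intro orth_proj_eqI)
       (auto simp: subspace_0 orthogonal_comp_def orthogonal_commute orthogonal_clauses)
qed

subsection \<open>Linear objectives on unions of polytopes\<close>

text \<open>A union of optimal faces need not be convex, so convexity is asked only of a piece
  around each point. By Krein-Milman each piece is the hull of its extreme points, all of which lie
  in the one set \<open>V\<close>.\<close>

definition covered_by_hulls :: "'a::euclidean_space set \<Rightarrow> 'a set \<Rightarrow> bool" where
  "covered_by_hulls R V \<longleftrightarrow>
     (\<forall>x\<in>R. \<exists>F. x \<in> F \<and> F \<subseteq> R \<and> compact F \<and> convex F \<and> {v. v extreme_point_of F} \<subseteq> V)"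

lemma convex_hull_subset_coset:
  assumes "subspace W" "\<And>u. u \<in> S \<Longrightarrow> u - v \<in> W"
  shows "y \<in> convex hull S \<Longrightarrow> y - v \<in> W"
proof -
  have "convex ((+) v ` W)"
    by (intro convex_translation subspace_imp_convex assms(1))
  moreover have "S \<subseteq> (+) v ` W"
    using assms(2) by (force simp: image_iff algebra_simps)
  ultimately have "convex hull S \<subseteq> (+) v ` W"
    by (rule hull_minimal[rotated])
  then show "y \<in> convex hull S \<Longrightarrow> y - v \<in> W" by auto
qed

lemma covered_by_hullsE:
  assumes "covered_by_hulls R V" "x \<in> R"
  obtains F where "x \<in> F" "F \<subseteq> R" "compact F" "convex F" "{v. v extreme_point_of F} \<subseteq> V"
    "F = convex hull {v. v extreme_point_of F}"
  using assms Krein_Milman_Minkowski unfolding covered_by_hulls_def by metis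

lemma covered_subset_coset:
  assumes "covered_by_hulls R V" "subspace W" "\<And>u. u \<in> V \<Longrightarrow> u - v \<in> W" "y \<in> R"
  shows "y - v \<in> W"
proof -
  obtain F where F: "y \<in> F" "{v. v extreme_point_of F} \<subseteq> V"
    "F = convex hull {v. v extreme_point_of F}"
    using assms(1,4) by (rule covered_by_hullsE)
  show ?thesis
    using convex_hull_subset_coset[of W "{v. v extreme_point_of F}" v y] F assms(2,3) by auto
qed

text \<open>The least value of the functional over the finite set \<open>V\<close> bounds it on
  every hull, because a half-space containing the extreme points of a piece contains the whole
  piece.\<close>

lemma covered_minimum_at_vertex:
  assumes "covered_by_hulls R V" "finite V" "R \<noteq> {}"
  shows "\<exists>v\<in>V. \<forall>y\<in>R. p \<bullet> v \<le> p \<bullet> y"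
proof -
  have "V \<noteq> {}"
  proof
    assume "V = {}"
    obtain x where "x \<in> R" using assms(3) by blast
    then obtain F where "x \<in> F" "{v. v extreme_point_of F} \<subseteq> V"
      "F = convex hull {v. v extreme_point_of F}"
      using covered_by_hullsE[OF assms(1)] by metis
    with \<open>V = {}\<close> show False by auto
  qed
  then obtain v where v: "v \<in> V" "\<And>u. u \<in> V \<Longrightarrow> p \<bullet> v \<le> p \<bullet> u"
    using ex_is_arg_min_if_finite[OF assms(2), of "\<lambda>u. p \<bullet> u"]
    by (auto simp: is_arg_min_linorder)
  have "p \<bullet> v \<le> p \<bullet> y" if y: "y \<in> R" for y
  proof -
    obtain F where F: "y \<in> F" "{v. v extreme_point_of F} \<subseteq> V"
      "F = convex hull {v. v extreme_point_of F}"
      using assms(1) y by (rule covered_by_hullsE)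
    have "convex hull {v. v extreme_point_of F} \<subseteq> {z. p \<bullet> z \<ge> p \<bullet> v}"
      using F(2) v(2) by (intro hull_minimal convex_halfspace_ge) auto
    then show ?thesis using F by auto
  qed
  then show ?thesis using v(1) by blast
qed

text \<open>The minimizers within a hull form a face of it, whose vertices all have the same objective
  value.\<close>

lemma minimizer_congruent_vertex:
  assumes "covered_by_hulls R V" "subspace W"
    and "\<And>u v. u \<in> V \<Longrightarrow> v \<in> V \<Longrightarrow> p \<bullet> (u - v) = 0 \<Longrightarrow> u - v \<in> W"
    and "x \<in> R" "\<And>y. y \<in> R \<Longrightarrow> p \<bullet> x \<le> p \<bullet> y"
  shows "\<exists>v\<in>V. x - v \<in> W"
proof -
  obtain F where F: "x \<in> F" "F \<subseteq> R" "compact F" "convex F" "{v. v extreme_point_of F} \<subseteq> V"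
    using assms(1,4) by (rule covered_by_hullsE)
  define G where "G = F \<inter> {y. p \<bullet> y = p \<bullet> x}"
  have G: "G face_of F"
    unfolding G_def using F assms(5) by (intro face_of_Int_supporting_hyperplane_ge) auto
  have hull: "G = convex hull {v. v extreme_point_of G}"
    using G F(3,4) by (intro Krein_Milman_Minkowski) (auto intro: face_of_imp_compact face_of_imp_convex)
  have ext: "u \<in> V \<and> p \<bullet> u = p \<bullet> x" if "u extreme_point_of G" for u
    using that F(5) extreme_point_of_face[OF G] by (auto simp: G_def)
  have "x \<in> G" using F(1) by (simp add: G_def)
  then obtain v where v: "v extreme_point_of G"
    using hull by (metis (mono_tags, lifting) empty_Collect_eq convex_hull_empty empty_iff)
  have "u - v \<in> W" if "u extreme_point_of G" for u
    using ext[OF that] ext[OF v] assms(3) by (auto simp: inner_diff_right)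
  then have "x - v \<in> W"
    using \<open>x \<in> G\<close> hull convex_hull_subset_coset[of W "{v. v extreme_point_of G}" v x] assms(2)
    by auto
  with v ext show ?thesis by blast
qed

lemma polyhedron_feasible_region: "polyhedron (feasible_region A b)"
proof -
  have "feasible_region A b =
      (\<Inter>i. {x. row i A \<bullet> x = b $ i}) \<inter> (\<Inter>i. {x. axis i 1 \<bullet> x \<ge> 0})"
    by (auto simp: feasible_region_def vec_eq_iff matrix_vector_mult_def row_def inner_vec_def
        axis_def if_distrib if_distribR cong: if_cong)
  then show ?thesis
    by (auto intro!: polyhedron_Int polyhedron_Inter polyhedron_hyperplane polyhedron_halfspace_ge)
qed

text \<open>Each optimum lies in the optimal face of its cost vector. Extreme points of a face are
  extreme points of the whole polytope, so \<open>V\<close> is finite even when \<open>C\<close> is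
  infinite.\<close>

lemma reachable_optima_covered:
  assumes "bounded (feasible_region A b)"
  obtains V where "finite V" "V \<subseteq> reachable_optima A b C" "covered_by_hulls (reachable_optima A b C) V"
proof
  let ?X = "feasible_region A b" and ?R = "reachable_optima A b C"
  let ?V = "{v. v extreme_point_of ?X} \<inter> ?R"
  show "finite ?V"
    using finite_polyhedron_extreme_points[OF polyhedron_feasible_region] by blast
  show "?V \<subseteq> ?R" by blast
  have X: "convex ?X" "compact ?X"
    by (simp_all add: polyhedron_imp_convex polyhedron_imp_closed polyhedron_feasible_region
        compact_eq_bounded_closed assms)
  have "\<exists>F. x \<in> F \<and> F \<subseteq> ?R \<and> compact F \<and> convex F \<and> {v. v extreme_point_of F} \<subseteq> ?V"
    if x_mem: "x \<in> ?R" for x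
  proof -
    obtain c where c: "c \<in> C" and "x \<in> argmin_linear c ?X"
      using x_mem by (auto simp: reachable_optima_def)
    then have x: "x \<in> ?X" "\<And>y. y \<in> ?X \<Longrightarrow> c \<bullet> x \<le> c \<bullet> y"
      by (auto simp: argmin_linear_def is_arg_min_linorder)
    let ?F = "?X \<inter> {y. c \<bullet> y = c \<bullet> x}"
    have F: "?F face_of ?X"
      using X x by (intro face_of_Int_supporting_hyperplane_ge) auto
    have "?F \<subseteq> argmin_linear c ?X"
      using x(2) by (auto simp: argmin_linear_def is_arg_min_linorder)
    then have "?F \<subseteq> ?R"
      using c by (auto simp: reachable_optima_def)
    moreover have "{v. v extreme_point_of ?F} \<subseteq> ?V"
      using extreme_point_of_face[OF F] \<open>?F \<subseteq> ?R\<close> by blast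
    moreover have "compact ?F" "convex ?F"
      using face_of_imp_compact[OF X F] face_of_imp_convex[OF F] .
    moreover have "x \<in> ?F"
      using x(1) by simp
    ultimately show ?thesis
      by (intro exI[of _ ?F] conjI)
  qed
  then show "covered_by_hulls ?R ?V"
    unfolding covered_by_hulls_def by blast
qed

subsection \<open>One iteration of the loop\<close>

text \<open>The objective depends on x alone and equals
  \<open>p \<bullet> x0 - p \<bullet> x\<close>. Its minimizers are the maximizers of
  \<open>p\<close> and conversely, which the symmetric disjunction absorbs.\<close>

lemma loop_candidates_iff:
  fixes A :: "real^'d^'m" and a x0 :: "real^'d" and D R :: "(real^'d) set"
  assumes "{x. \<exists>lam s c tau. (x, lam, s, c, tau) \<in> milp_feasible A b C eps} = R"
  defines "p \<equiv> orth_proj (orthogonal_comp (span D)) a"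
  shows "x \<in> loop_candidates A b C eps x0 a D \<longleftrightarrow>
    x \<in> R \<and> p \<bullet> (x - x0) \<noteq> 0 \<and> ((\<forall>y\<in>R. p \<bullet> x \<le> p \<bullet> y) \<or> (\<forall>y\<in>R. p \<bullet> y \<le> p \<bullet> x))"
proof -
  have obj: "milp_objective x0 a D z = p \<bullet> x0 - p \<bullet> fst z" for z :: "_ \<times> (real^'m) \<times> _ \<times> _ \<times> _"
    by (cases z) (simp add: milp_objective_def p_def inner_diff_right
        orth_proj_adjoint[OF subspace_orthogonal_comp])
  have "(\<forall>z \<in> milp_feasible A b C eps. P (fst z)) \<longleftrightarrow> (\<forall>y\<in>R. P y)" for P
    unfolding assms(1)[symmetric] by fastforce
  from this[of "\<lambda>y. p \<bullet> x \<le> p \<bullet> y"] this[of "\<lambda>y. p \<bullet> y \<le> p \<bullet> x"] show ?thesis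
    unfolding loop_candidates_def is_arg_min_linorder is_arg_max_linorder mem_Collect_eq obj
      inner_diff_right assms(1)[symmetric]
    by (simp add: Ball_def eq_commute[of "p \<bullet> x0" "p \<bullet> x"]) blast
qed

text \<open>The projected sample is orthogonal to \<open>W\<close>, so the converse implication
  always holds: a generic sample takes equal values on two points of \<open>S\<close> exactly when
  they agree modulo \<open>W\<close>.\<close>

definition generic_for :: "(real^'d) set \<Rightarrow> (real^'d) set \<Rightarrow> real^'d \<Rightarrow> bool" where
  "generic_for W S a \<longleftrightarrow>
     (\<forall>u\<in>S. \<forall>v\<in>S. orth_proj (orthogonal_comp W) a \<bullet> (u - v) = 0 \<longrightarrow> u - v \<in> W)"

text \<open>The second conclusion makes the new direction independent of the old ones. The third
  lets a vertex stand in for \<open>x\<close> modulo \<open>span D\<close>, although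
  \<open>x\<close> itself need not be a vertex.\<close>

lemma loop_candidate_step:
  assumes feas: "{x. \<exists>lam s c tau. (x, lam, s, c, tau) \<in> milp_feasible A b C eps} = R"
    and cov: "covered_by_hulls R V"
    and gen: "generic_for (span D) (insert x0 V) a"
    and x: "x \<in> loop_candidates A b C eps x0 a D"
  shows "x \<in> R" "x - x0 \<notin> span D" "\<exists>v\<in>V. x - v \<in> span D"
proof -
  define p where "p = orth_proj (orthogonal_comp (span D)) a"
  have *: "x \<in> R" "p \<bullet> (x - x0) \<noteq> 0" "(\<forall>y\<in>R. p \<bullet> x \<le> p \<bullet> y) \<or> (\<forall>y\<in>R. p \<bullet> y \<le> p \<bullet> x)"
    using x loop_candidates_iff[OF feas] unfolding p_def by blast+
  show "x \<in> R" by fact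
  have "p \<in> orthogonal_comp (span D)"
    unfolding p_def by (intro orth_proj subspace_orthogonal_comp)
  then show "x - x0 \<notin> span D"
    using *(2) by (auto simp: orthogonal_comp_def orthogonal_def inner_commute)
  have g: "\<And>u v. u \<in> V \<Longrightarrow> v \<in> V \<Longrightarrow> p \<bullet> (u - v) = 0 \<Longrightarrow> u - v \<in> span D"
    using gen by (auto simp: generic_for_def p_def)
  show "\<exists>v\<in>V. x - v \<in> span D"
    using *(3)
  proof
    assume "\<forall>y\<in>R. p \<bullet> x \<le> p \<bullet> y"
    with cov g *(1) show ?thesis
      by (intro minimizer_congruent_vertex[of R V _ p]) auto
  next
    assume "\<forall>y\<in>R. p \<bullet> y \<le> p \<bullet> x"
    with cov g *(1) show ?thesis
      \<comment> \<open>A maximizer of \<open>p\<close> minimizes \<open>- p\<close>, and genericity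
        is insensitive to the sign.\<close>
      by (intro minimizer_congruent_vertex[of R V _ "- p"]) auto
  qed
qed

text \<open>If all vertices were congruent to \<open>x0\<close> modulo \<open>span D\<close>, so
  would be all of \<open>R\<close>. Hence some vertex \<open>v\<close> escapes, and genericity gives
  it a value of \<open>p\<close> different from that at \<open>x0\<close>. As this value lies
  between the minimum and the maximum of \<open>p\<close>, these cannot both equal
  \<open>p \<bullet> x0\<close>.\<close>

lemma loop_guard_iff:
  assumes feas: "{x. \<exists>lam s c tau. (x, lam, s, c, tau) \<in> milp_feasible A b C eps} = R"
    and cov: "covered_by_hulls R V" and V: "finite V" "V \<subseteq> R"
    and gen: "generic_for (span D) (insert x0 V) a"
  shows "loop_guard A b C eps x0 a D \<longleftrightarrow> (\<exists>x\<in>R. x - x0 \<notin> span D)"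
proof
  assume "loop_guard A b C eps x0 a D"
  then show "\<exists>x\<in>R. x - x0 \<notin> span D"
    using loop_candidate_step[OF feas cov gen] by (auto simp: loop_guard_def)
next
  define p where "p = orth_proj (orthogonal_comp (span D)) a"
  assume "\<exists>x\<in>R. x - x0 \<notin> span D"
  then obtain v where v: "v \<in> V" "v - x0 \<notin> span D" and "R \<noteq> {}"
    using covered_subset_coset[OF cov subspace_span] by blast
  then have "p \<bullet> (v - x0) \<noteq> 0"
    using gen by (auto simp: generic_for_def p_def)
  obtain v1 where v1: "v1 \<in> V" "\<And>y. y \<in> R \<Longrightarrow> p \<bullet> v1 \<le> p \<bullet> y"
    using covered_minimum_at_vertex[OF cov V(1) \<open>R \<noteq> {}\<close>] by blast
  obtain v2 where v2: "v2 \<in> V" "\<And>y. y \<in> R \<Longrightarrow> - p \<bullet> v2 \<le> - p \<bullet> y"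
    using covered_minimum_at_vertex[OF cov V(1) \<open>R \<noteq> {}\<close>] by blast
  have "p \<bullet> (v1 - x0) \<noteq> 0 \<or> p \<bullet> (v2 - x0) \<noteq> 0"
    using \<open>p \<bullet> (v - x0) \<noteq> 0\<close> v1(2)[of v] v2(2)[of v] v(1) V(2)
    by (auto simp: inner_diff_right)
  then have "v1 \<in> loop_candidates A b C eps x0 a D \<or> v2 \<in> loop_candidates A b C eps x0 a D"
    unfolding loop_candidates_iff[OF feas] p_def[symmetric] using v1 v2 V(2) by auto
  then show "loop_guard A b C eps x0 a D"
    by (auto simp: loop_guard_def)
qed

subsection \<open>Gaussian samples are generic\<close>

text \<open>For a fixed difference z outside \<open>W\<close>, the bad samples form the hyperplane
  orthogonal to the nonzero projection of z onto the complement of \<open>W\<close>. It is Lebesgue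
  null, hence null for a law with a density, and \<open>S\<close> has only finitely many
  differences.\<close>

lemma AE_generic_for:
  fixes W S :: "(real^'d) set"
  assumes X: "distributed M lborel X (\<lambda>x. ennreal (std_gaussian_density x))"
    and "subspace W" "finite S"
  shows "AE w in M. generic_for W S (X w)"
proof -
  have "AE w in M. orth_proj (orthogonal_comp W) (X w) \<bullet> z = 0 \<longrightarrow> z \<in> W" for z
  proof (cases "z \<in> W")
    case False
    define q where "q = orth_proj (orthogonal_comp W) z"
    have q: "q \<noteq> 0"
      using False assms(2) by (simp add: q_def orth_proj_orthogonal_comp_eq_0_iff)
    have "negligible {a. q \<bullet> a = 0}"
      using q by (intro negligible_hyperplane) simp
    moreover have [measurable]: "{a. q \<bullet> a = 0} \<in> sets borel"
      by (simp add: closed_hyperplane borel_closed)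
    ultimately have "{a. q \<bullet> a = 0} \<in> null_sets lborel"
      by (simp add: negligible_iff_null_sets null_sets_completion_iff)
    then have "AE a in lborel. q \<bullet> a \<noteq> 0"
      by (auto dest: AE_not_in)
    then have "AE a in density lborel (\<lambda>x. ennreal (std_gaussian_density x)). q \<bullet> a \<noteq> 0"
      using distributed_borel_measurable[OF X] by (subst AE_density) auto
    then have "AE a in distr M lborel X. q \<bullet> a \<noteq> 0"
      unfolding distributed_distr_eq_density[OF X] .
    then have "AE w in M. q \<bullet> X w \<noteq> 0"
      using distributed_measurable[OF X] by (subst (asm) AE_distr_iff) (auto simp: q_def)
    moreover have "q \<bullet> X w = orth_proj (orthogonal_comp W) (X w) \<bullet> z" for w
      using orth_proj_adjoint[OF subspace_orthogonal_comp] by (metis q_def inner_commute)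
    ultimately have "AE w in M. orth_proj (orthogonal_comp W) (X w) \<bullet> z \<noteq> 0"
      by simp
    then show ?thesis
      by eventually_elim simp
  qed auto
  then show ?thesis
    unfolding generic_for_def using assms(3) by (auto simp: AE_finite_all)
qed

subsection \<open>Executions with generic samples\<close>

lemma dir_subset_iff:
  assumes "x0 \<in> R" "subspace W"
  shows "dir R \<subseteq> W \<longleftrightarrow> (\<forall>x\<in>R. x - x0 \<in> W)"
proof
  assume "dir R \<subseteq> W"
  then show "\<forall>x\<in>R. x - x0 \<in> W"
    using assms(1) by (auto simp: dir_def intro!: span_base)
next
  assume *: "\<forall>x\<in>R. x - x0 \<in> W"
  have "x1 - x2 \<in> W" if "x1 \<in> R" "x2 \<in> R" for x1 x2
    using subspace_diff[OF assms(2), of "x1 - x0" "x2 - x0"] * that by simp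
  then show "dir R \<subseteq> W"
    unfolding dir_def using assms(2) by (intro span_minimal) auto
qed

lemma generic_execution:
  fixes x0 :: "real^'d" and R :: "(real^'d) set"
  assumes feas: "{x. \<exists>lam s c tau. (x, lam, s, c, tau) \<in> milp_feasible A b C eps} = R"
    and cov: "covered_by_hulls R V" and V: "finite V" "V \<subseteq> R"
    and x0: "x0 \<in> R"
    and gen: "\<And>k T. T \<subseteq> V \<Longrightarrow> generic_for (span ((\<lambda>v. v - x0) ` T)) (insert x0 V) (a k)"
    and ex: "execution A b C eps x0 a D"
  defines "n \<equiv> dim (dir R)"
  shows "terminates_after A b C eps x0 a D n \<and> independent (D n) \<and> span (D n) = dir R"
proof -
  \<comment> \<open>The bound \<open>k \<le> n\<close> matters because \<open>D\<close> is
    unconstrained once the guard has failed. The last clause places the current span in the finite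
    family for which every sample is known to be generic.\<close>
  have inv: "(\<forall>j<k. loop_guard A b C eps x0 (a j) (D j)) \<and> independent (D k) \<and> finite (D k) \<and>
      card (D k) = k \<and> span (D k) \<subseteq> dir R \<and> (\<exists>T\<subseteq>V. span (D k) = span ((\<lambda>v. v - x0) ` T))"
    if "k \<le> n" for k
    using that
  proof (induction k)
    case 0
    have "D 0 = {}" using ex by (simp add: execution_def)
    moreover have "\<exists>T\<subseteq>V. span {} = span ((\<lambda>v. v - x0) ` T)"
      by (metis empty_subsetI image_empty)
    ultimately show ?case
      by (simp add: dir_def span_zero independent_empty)
  next
    case (Suc k)
    then have guards: "\<forall>j<k. loop_guard A b C eps x0 (a j) (D j)"
      and ind: "independent (D k)" "finite (D k)" "card (D k) = k" and sub: "span (D k) \<subseteq> dir R"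
      and "\<exists>T\<subseteq>V. span (D k) = span ((\<lambda>v. v - x0) ` T)" and "k < n"
      by simp_all
    from this(6) obtain T where T: "T \<subseteq> V" "span (D k) = span ((\<lambda>v. v - x0) ` T)" by blast
    have g: "generic_for (span (D k)) (insert x0 V) (a k)"
      using gen T by simp
    \<comment> \<open>Fewer than \<open>n\<close> vectors cannot span a space of dimension
      \<open>n\<close>, so some optimum still escapes and the guard holds.\<close>
    have "\<not> dir R \<subseteq> span (D k)"
    proof
      assume "dir R \<subseteq> span (D k)"
      then have "n \<le> card (D k)"
        unfolding n_def by (intro dim_le_card ind)
      with ind \<open>k < n\<close> show False by simp
    qed
    then have "loop_guard A b C eps x0 (a k) (D k)"
      using loop_guard_iff[OF feas cov V g] dir_subset_iff[OF x0] by auto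
    then have guards': "\<forall>j\<le>k. loop_guard A b C eps x0 (a j) (D j)"
      using guards by (auto simp: le_less)
    then obtain x where x: "x \<in> loop_candidates A b C eps x0 (a k) (D k)"
      and D: "D (Suc k) = insert (x - x0) (D k)"
      using ex by (auto simp: execution_def)
    note step = loop_candidate_step[OF feas cov g x]
    obtain v where v: "v \<in> V" "x - v \<in> span (D k)" using step(3) by blast
    have new: "x - x0 \<notin> D k"
      using step(2) span_base by blast
    have "x - x0 \<in> dir R"
      using dir_subset_iff[OF x0, of "dir R"] step(1) by (auto simp: dir_def)
    then have "D (Suc k) \<subseteq> dir R"
      using sub span_superset[of "D k"] by (simp add: D)
    then have "span (D (Suc k)) \<subseteq> dir R"
      unfolding dir_def by (intro span_minimal subspace_span)
    moreover have "span (D (Suc k)) = span ((\<lambda>v. v - x0) ` insert v T)"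
    proof -
      \<comment> \<open>The vectors \<open>x - x0\<close> and \<open>v - x0\<close> differ by
        \<open>x - v\<close>, which already lies in \<open>span (D k)\<close>.\<close>
      have "span (D (Suc k)) = span (insert (v - x0) (D k))"
        unfolding D using v(2) by (intro eq_span_insert_eq) simp
      also have "\<dots> = span (insert (v - x0) ((\<lambda>v. v - x0) ` T))"
        by (simp only: span_insert T(2))
      finally show ?thesis by simp
    qed
    moreover have "independent (D (Suc k))"
      using ind step(2) by (simp add: D independent_insert new)
    moreover have "insert v T \<subseteq> V"
      using T(1) v(1) by simp
    moreover have "finite (D (Suc k))" "card (D (Suc k)) = Suc k"
      using ind new by (simp_all add: D)
    ultimately show ?case
      using guards' unfolding less_Suc_eq_le by blast
  qed
  have n: "\<forall>j<n. loop_guard A b C eps x0 (a j) (D j)" "independent (D n)" "finite (D n)"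
      "card (D n) = n" "span (D n) \<subseteq> dir R" "\<exists>T\<subseteq>V. span (D n) = span ((\<lambda>v. v - x0) ` T)"
    using inv[of n] by simp_all
  have "subspace (dir R)" by (simp add: dir_def)
  \<comment> \<open>The \<open>n\<close> independent vectors fill \<open>dir R\<close>, so no
    optimum escapes their span and the guard fails at test \<open>n\<close>.\<close>
  moreover have "dim (span (D n)) = dim (dir R)"
    using n(2,4) by (metis dim_span dim_eq_card_independent n_def)
  ultimately have eq: "span (D n) = dir R"
    by (intro subspace_dim_equal subspace_span n(5)) simp_all
  have "generic_for (span (D n)) (insert x0 V) (a n)"
    using n(6) gen by metis
  then have "\<not> loop_guard A b C eps x0 (a n) (D n)"
    using loop_guard_iff[OF feas cov V] dir_subset_iff[OF x0, of "dir R"] eq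
    by (auto simp: dir_def)
  then show ?thesis
    using n(1,2) eq unfolding terminates_after_def by blast
qed

theorem theorem4:
  fixes A :: "real^'d^'m" and b :: "real^'m" and C :: "(real^'d) set"
    and eps :: real and c0 x0 :: "real^'d"
    and M :: "'w measure" and alpha :: "nat \<Rightarrow> 'w \<Rightarrow> real^'d"
  assumes "feasible_region A b \<noteq> {}" and "bounded (feasible_region A b)"
    and "C \<noteq> {}"
    and "eps > 0"
    and "{x. \<exists>lam s c tau. (x, lam, s, c, tau) \<in> milp_feasible A b C eps} = reachable_optima A b C"
    and "c0 \<in> C" and "x0 \<in> argmin_linear c0 (feasible_region A b)"
    and "prob_space M"
    and "prob_space.indep_vars M (\<lambda>_. borel) alpha UNIV"
    and "\<And>k. distributed M lborel (alpha k) (\<lambda>x. ennreal (std_gaussian_density x))"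
  shows "dim (dir (reachable_optima A b C)) \<le> CARD('d) \<and>
    (AE w in M. \<forall>D. execution A b C eps x0 (\<lambda>k. alpha k w) D \<longrightarrow>
       (let n = dim (dir (reachable_optima A b C)) in
          terminates_after A b C eps x0 (\<lambda>k. alpha k w) D n \<and>
          independent (D n) \<and> span (D n) = dir (reachable_optima A b C)))"
proof -
  let ?R = "reachable_optima A b C"
  obtain V where V: "finite V" "V \<subseteq> ?R" "covered_by_hulls ?R V"
    using assms(2) by (rule reachable_optima_covered)
  have x0: "x0 \<in> ?R"
    using assms(6,7) by (auto simp: reachable_optima_def)
  \<comment> \<open>Countably many tests and finitely many \<open>T\<close> give one null set that
    does not mention \<open>D\<close>; the possibly uncountable quantifier over executions can then
    go inside.\<close>
  have "AE w in M. \<forall>k. \<forall>T\<in>Pow V. generic_for (span ((\<lambda>v. v - x0) ` T)) (insert x0 V) (alpha k w)"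
    unfolding AE_all_countable using V(1)
    by (intro allI AE_finite_allI AE_generic_for assms(10)) auto
  then have "AE w in M. \<forall>D. execution A b C eps x0 (\<lambda>k. alpha k w) D \<longrightarrow>
       (let n = dim (dir ?R) in
          terminates_after A b C eps x0 (\<lambda>k. alpha k w) D n \<and>
          independent (D n) \<and> span (D n) = dir ?R)"
  proof eventually_elim
    case (elim w)
    then show ?case
      unfolding Let_def by (intro allI impI generic_execution[OF assms(5) V(3,1,2) x0]) auto
  qed
  moreover have "dim (dir ?R) \<le> CARD('d)"
    using dim_subset_UNIV_cart by blast
  ultimately show ?thesis by blast
qed

end
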